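(* Let $X$ be a real Hausdorff locally convex topological vector space, let $F$ be a convex subset of $X$ with $0\in\operatorname{int}(F)$, and let $\Omega$ be a proper subset of $X$ (i.e., both $\Omega$ and $\Omega^c$ are nonempty). Then $$\Delta_{\Omega}^F(x)=(\mu_{\Omega}^F\oplus\rho_F)(x)\quad\text{for all }x\in\Omega.$$ If in addition $F$ is symmetric, then this equality holds for all $x\in X$.
   Context: $\Omega^c=X\setminus\Omega$. For nonempty $A\subset X$, the minimal time function is $\mathcal{T}_{A}^F(x):=\inf\{t>0\mid (x+tF)\cap A\neq\emptyset\}$. The signed minimal time function is $\Delta_{\Omega}^F(x):=\mathcal{T}_{\Omega}^F(x)$ if $x\notin\Omega$ and $\Delta_{\Omega}^F(x):=-\mathcal{T}_{\Omega^c}^F(x)$ if $x\in\Omega$. The function $\mu_{\Omega}^F:X\to(-\infty,\infty]$ is $\mu_{\Omega}^F(x):=\infty$ if $x\in\Omega^c$ and $\mu_{\Omega}^F(x):=-\mathcal{T}_{\Omega^c}^F(x)$ if $x\in\Omega$. The Minkowski gauge is $\rho_F(x):=\inf\{t>0\mid x\in tF\}$. The infimal convolution of $f,g:X\to(-\infty,\infty]$ is $(f\oplus g)(x):=\inf\{f(y)+g(x-y)\mid y\in X\}$. $F$ symmetric means $F=-F$. *)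

theory Defs
  imports "HOL-Analysis.Analysis"
begin

text \<open>Continuity of negation, part of \<open>topological_ab_group_add\<close>, follows from that of
  scalar multiplication, so the first class is exactly that of real topological vector spaces.\<close>

class topological_real_vector = real_vector + topological_ab_group_add +
  assumes tendsto_scaleR_Pair:
    "filterlim (\<lambda>p. fst p *\<^sub>R snd p) (nhds (c *\<^sub>R x)) (nhds (c::real) \<times>\<^sub>F nhds x)"

class locally_convex_space = topological_real_vector +
  assumes convex_neighbourhood_0_aux:
    "open U \<Longrightarrow> 0 \<in> U \<Longrightarrow> \<exists>V. open V \<and>
       (\<forall>x\<in>V. \<forall>y\<in>V. \<forall>u\<ge>0. \<forall>v\<ge>0. u + v = 1 \<longrightarrow> u *\<^sub>R x + v *\<^sub>R y \<in> V)
       \<and> 0 \<in> V \<and> V \<subseteq> U"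

text \<open>The class axiom spells out \<^const>\<open>convex\<close>, whose sort constraint is not
  accepted inside a class specification.\<close>

lemma convex_neighbourhood_0:
  fixes U :: "'a::locally_convex_space set"
  assumes "open U" "0 \<in> U"
  shows "\<exists>V. open V \<and> convex V \<and> 0 \<in> V \<and> V \<subseteq> U"
  unfolding convex_def using convex_neighbourhood_0_aux[OF assms] .

instance real_normed_vector \<subseteq> locally_convex_space
proof
  show "filterlim (\<lambda>p. fst p *\<^sub>R snd p) (nhds (c *\<^sub>R x)) (nhds c \<times>\<^sub>F nhds x)"
    for c :: real and x :: 'a
    by (rule tendsto_scaleR) (rule filterlim_fst, rule filterlim_snd)
  show "\<exists>V. open V \<and>
       (\<forall>x\<in>V. \<forall>y\<in>V. \<forall>u\<ge>0. \<forall>v\<ge>0. u + v = 1 \<longrightarrow> u *\<^sub>R x + v *\<^sub>R y \<in> V)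
       \<and> 0 \<in> V \<and> V \<subseteq> U" if "open U" "0 \<in> U" for U :: "'a set"
    using that unfolding convex_def[symmetric]
    by (metis open_contains_ball open_ball convex_ball centre_in_ball)
qed

text \<open>All functions take values in \<^typ>\<open>ereal\<close>, where the infimum of the empty set is \<open>\<infinity>\<close>.\<close>

definition min_time :: "'a::real_vector set \<Rightarrow> 'a set \<Rightarrow> 'a \<Rightarrow> ereal" where
  "min_time F A x =
    Inf (ereal ` {t. 0 < t \<and> (\<lambda>f. x + t *\<^sub>R f) ` F \<inter> A \<noteq> {}})"

definition signed_min_time :: "'a::real_vector set \<Rightarrow> 'a set \<Rightarrow> 'a \<Rightarrow> ereal" where
  "signed_min_time F \<Omega> x = (if x \<in> \<Omega> then - min_time F (- \<Omega>) x else min_time F \<Omega> x)"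

definition inner_min_time :: "'a::real_vector set \<Rightarrow> 'a set \<Rightarrow> 'a \<Rightarrow> ereal" where
  "inner_min_time F \<Omega> x = (if x \<in> \<Omega> then - min_time F (- \<Omega>) x else \<infinity>)"

definition minkowski_gauge :: "'a::real_vector set \<Rightarrow> 'a \<Rightarrow> ereal" where
  "minkowski_gauge F x = Inf (ereal ` {t. 0 < t \<and> x \<in> (\<lambda>f. t *\<^sub>R f) ` F})"

text \<open>Meant for \<open>f\<close> and \<open>g\<close> that do not attain \<open>-\<infinity>\<close>; in \<^typ>\<open>ereal\<close>, \<open>\<infinity> + (-\<infinity>) = \<infinity>\<close>.\<close>

definition inf_convolution ::
  "('a::real_vector \<Rightarrow> ereal) \<Rightarrow> ('a \<Rightarrow> ereal) \<Rightarrow> 'a \<Rightarrow> ereal" where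
  "inf_convolution f g x = (INF y. f y + g (x - y))"

end

theory Submission
  imports Defs
begin

text \<open>The minimal time function is an infimum of gauges, \<open>T A x = (INF a\<in>A. \<rho> (a - x))\<close>, so
  subadditivity of \<open>\<rho>\<close> gives \<open>T A y \<le> \<rho> (x - y) + T A x\<close>; for \<open>A = - \<Omega>\<close> and \<open>x \<in> \<Omega>\<close> this says that
  the infimal convolution is attained at \<open>y = x\<close>. For \<open>x \<notin> \<Omega>\<close> one needs
  \<open>T \<Omega> x + T (- \<Omega>) y \<le> \<rho> (x - y)\<close> for every \<open>y \<in> \<Omega>\<close>: dividing the segment from \<open>y\<close> to \<open>x\<close> into \<open>n\<close>
  equal pieces, some piece starts in \<open>\<Omega>\<close> and ends outside, and bounding both minimal times
  through its endpoints gives the estimate up to a factor \<open>1 + 1/n\<close>. Symmetry of \<open>F\<close> is used to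
  traverse the segment in both directions.\<close>

section \<open>Elementary properties of the Minkowski gauge\<close>

lemma minkowski_gauge_le:
  assumes "0 < t" "f \<in> F" "x = t *\<^sub>R f"
  shows "minkowski_gauge F x \<le> ereal t"
  unfolding minkowski_gauge_def by (rule Inf_lower) (use assms in auto)

lemma minkowski_gauge_greatest:
  assumes "\<And>t f. 0 < t \<Longrightarrow> f \<in> F \<Longrightarrow> x = t *\<^sub>R f \<Longrightarrow> c \<le> ereal t"
  shows "c \<le> minkowski_gauge F x"
  unfolding minkowski_gauge_def by (rule Inf_greatest) (use assms in auto)

lemma minkowski_gauge_nonneg: "0 \<le> minkowski_gauge F x"
  by (rule minkowski_gauge_greatest) simp

lemma minkowski_gauge_zero:
  assumes "0 \<in> F"
  shows "minkowski_gauge F 0 = 0"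
proof (rule antisym)
  show "minkowski_gauge F 0 \<le> 0"
  proof (rule ereal_le_epsilon2)
    fix e :: real assume "0 < e"
    then show "minkowski_gauge F 0 \<le> 0 + ereal e"
      using minkowski_gauge_le[of e 0 F 0] assms by simp
  qed
qed (rule minkowski_gauge_nonneg)

lemma minkowski_gauge_uminus:
  assumes "F = uminus ` F"
  shows "minkowski_gauge F (- x) = minkowski_gauge F x"
proof -
  have *: "minkowski_gauge F (- z) \<le> minkowski_gauge F z" for z
  proof (rule minkowski_gauge_greatest)
    fix t f assume "0 < t" "f \<in> F" "z = t *\<^sub>R f"
    moreover have "- f \<in> F" using \<open>f \<in> F\<close> assms by blast
    ultimately show "minkowski_gauge F (- z) \<le> ereal t"
      by (intro minkowski_gauge_le[of t "- f"]) auto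
  qed
  show ?thesis using *[of x] *[of "- x"] by simp
qed

text \<open>By continuity of scaling, \<open>r *\<^sub>R x\<close> tends to \<open>0\<close> as
  \<open>r\<close> decreases to \<open>0\<close>, so it enters \<open>interior F\<close> for some
  positive \<open>r\<close>. Finite values later allow rearrangements in \<open>ereal\<close>
  without undefined differences.\<close>

lemma minkowski_gauge_finite:
  fixes F :: "'a::topological_real_vector set"
  assumes "0 \<in> interior F"
  obtains r where "0 \<le> r" "minkowski_gauge F x = ereal r"
proof -
  \<comment> \<open>The limit is stated through pairs so that it matches
    \<open>tendsto_scaleR_Pair\<close>.\<close>
  have "((\<lambda>r. fst (r, x) *\<^sub>R snd (r, x)) \<longlongrightarrow> 0 *\<^sub>R x) (at_right (0::real))"
    by (rule filterlim_compose[OF tendsto_scaleR_Pair], rule filterlim_Pair)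
       (auto intro: tendsto_ident_at)
  then have "((\<lambda>r. r *\<^sub>R x) \<longlongrightarrow> 0) (at_right (0::real))" by simp
  then have "\<forall>\<^sub>F r in at_right (0::real). r *\<^sub>R x \<in> interior F"
    using assms by (rule topological_tendstoD[OF _ open_interior])
  then have "\<forall>\<^sub>F r in at_right (0::real). r *\<^sub>R x \<in> interior F \<and> 0 < r"
    by (intro eventually_conj eventually_at_right_less)
  then obtain r :: real where r: "r *\<^sub>R x \<in> interior F" "0 < r"
    using eventually_happens[of _ "at_right (0::real)"] by auto
  have "minkowski_gauge F x \<le> ereal (1 / r)"
    by (rule minkowski_gauge_le[of _ "r *\<^sub>R x"]) (use r interior_subset[of F] in auto)
  then show thesis
    using minkowski_gauge_nonneg[of F x] that
    by (cases "minkowski_gauge F x") auto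
qed

text \<open>If \<open>x = s *\<^sub>R f\<close> and \<open>y = t *\<^sub>R g\<close>, then
  \<open>x + y\<close> is \<open>s + t\<close> times the convex combination of \<open>f\<close> and
  \<open>g\<close> with weights \<open>s / (s + t)\<close> and \<open>t / (s + t)\<close>.\<close>

lemma minkowski_gauge_add_le:
  assumes "convex F"
  shows "minkowski_gauge F (x + y) \<le> minkowski_gauge F x + minkowski_gauge F y"
proof (cases "minkowski_gauge F x = \<infinity> \<or> minkowski_gauge F y = \<infinity>")
  case False
  then obtain a b where ab: "minkowski_gauge F x = ereal a" "minkowski_gauge F y = ereal b"
    using minkowski_gauge_nonneg[of F x] minkowski_gauge_nonneg[of F y]
    by (cases "minkowski_gauge F x"; cases "minkowski_gauge F y") auto
  have st: "minkowski_gauge F (x + y) \<le> ereal (s + t)"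
    if "0 < s" "f \<in> F" "x = s *\<^sub>R f" "0 < t" "g \<in> F" "y = t *\<^sub>R g" for s t f g
  proof (rule minkowski_gauge_le)
    show "(s / (s + t)) *\<^sub>R f + (t / (s + t)) *\<^sub>R g \<in> F"
      by (rule convexD[OF assms])
         (use that in \<open>simp_all flip: add_divide_distrib\<close>)
    show "x + y = (s + t) *\<^sub>R ((s / (s + t)) *\<^sub>R f + (t / (s + t)) *\<^sub>R g)"
      using that by (simp add: scaleR_add_right)
  qed (use that in simp)
  \<comment> \<open>The infima over \<open>s\<close> and \<open>t\<close> are taken one at a time,
    each with the other, finite summand moved to the left.\<close>
  have "minkowski_gauge F (x + y) - ereal a \<le> minkowski_gauge F y"
  proof (rule minkowski_gauge_greatest)
    fix t g assume t: "0 < t" "g \<in> F" "y = t *\<^sub>R g"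
    have "minkowski_gauge F (x + y) - ereal t \<le> minkowski_gauge F x"
      by (rule minkowski_gauge_greatest)
         (use st t in \<open>auto simp: ereal_minus_le_iff add.commute\<close>)
    then show "minkowski_gauge F (x + y) - ereal a \<le> ereal t"
      by (auto simp: ab ereal_minus_le_iff add.commute)
  qed
  then show ?thesis
    by (auto simp: ab ereal_minus_le_iff add.commute)
qed (use minkowski_gauge_nonneg in \<open>auto simp: ereal_plus_eq_PInfty\<close>)

lemma minkowski_gauge_scaleR_le:
  assumes "0 \<in> F" "0 \<le> c" "minkowski_gauge F x = ereal r"
  shows "minkowski_gauge F (c *\<^sub>R x) \<le> ereal (c * r)"
proof (cases "c = 0")
  case True
  then show ?thesis by (simp add: minkowski_gauge_zero[OF assms(1)])
next
  case False
  show ?thesis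
  proof (rule ereal_le_epsilon2)
    fix e :: real assume e: "0 < e"
    \<comment> \<open>The slack \<open>e / c\<close> becomes \<open>e\<close> after multiplication
      by \<open>c\<close>.\<close>
    have "minkowski_gauge F x < ereal (r + e / c)"
      using assms False e by simp
    then obtain t where t: "0 < t" "x \<in> (\<lambda>f. t *\<^sub>R f) ` F" "t < r + e / c"
      unfolding minkowski_gauge_def Inf_less_iff by auto
    then obtain f where f: "f \<in> F" "x = t *\<^sub>R f" by auto
    have "minkowski_gauge F (c *\<^sub>R x) \<le> ereal (c * t)"
      by (rule minkowski_gauge_le[of _ f]) (use assms False t f in auto)
    also have "c * t \<le> c * r + e"
      using mult_left_mono[of t "r + e / c" c] t assms False by (simp add: distrib_left)
    finally show "minkowski_gauge F (c *\<^sub>R x) \<le> ereal (c * r) + ereal e" by simp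
  qed
qed

section \<open>Minimal time functions as infima of gauges\<close>

text \<open>Since \<open>x + t *\<^sub>R f = a\<close> is the same as
  \<open>a - x = t *\<^sub>R f\<close>, both sides are one infimum over \<open>t\<close> and
  \<open>a\<close>, taken in different orders.\<close>

lemma min_time_eq_INF_gauge:
  "min_time F A x = (INF a\<in>A. minkowski_gauge F (a - x))"
proof (rule antisym)
  show "min_time F A x \<le> (INF a\<in>A. minkowski_gauge F (a - x))"
  proof (intro INF_greatest minkowski_gauge_greatest)
    fix a t f assume "a \<in> A" "0 < t" "f \<in> F" "a - x = t *\<^sub>R f"
    then have "x + t *\<^sub>R f \<in> A" by (simp flip: \<open>a - x = t *\<^sub>R f\<close>)
    with \<open>0 < t\<close> \<open>f \<in> F\<close> show "min_time F A x \<le> ereal t"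
      unfolding min_time_def by (intro Inf_lower) blast
  qed
  show "(INF a\<in>A. minkowski_gauge F (a - x)) \<le> min_time F A x"
    unfolding min_time_def
  proof (rule Inf_greatest)
    fix s assume "s \<in> ereal ` {t. 0 < t \<and> (\<lambda>f. x + t *\<^sub>R f) ` F \<inter> A \<noteq> {}}"
    then obtain t f where "s = ereal t" "0 < t" "f \<in> F" "x + t *\<^sub>R f \<in> A" by blast
    then show "(INF a\<in>A. minkowski_gauge F (a - x)) \<le> s"
      using minkowski_gauge_le[of t f F "t *\<^sub>R f"] by (intro INF_lower2[of "x + t *\<^sub>R f"]) auto
  qed
qed

lemma min_time_le_gauge: "a \<in> A \<Longrightarrow> min_time F A x \<le> minkowski_gauge F (a - x)"
  unfolding min_time_eq_INF_gauge by (rule INF_lower)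

lemma min_time_nonneg: "0 \<le> min_time F A x"
  unfolding min_time_eq_INF_gauge by (intro INF_greatest minkowski_gauge_nonneg)

lemma min_time_finite:
  fixes F :: "'a::topological_real_vector set"
  assumes "0 \<in> interior F" "A \<noteq> {}"
  obtains r where "0 \<le> r" "min_time F A x = ereal r"
proof -
  from assms(2) obtain a where "a \<in> A" by blast
  moreover obtain r where "minkowski_gauge F (a - x) = ereal r"
    using minkowski_gauge_finite[OF assms(1)] .
  ultimately have "min_time F A x \<le> ereal r"
    using min_time_le_gauge by metis
  then show thesis
    using min_time_nonneg[of F A x] that by (cases "min_time F A x") auto
qed

text \<open>Subadditivity of the gauge is applied to \<open>a - y = (x - y) + (a - x)\<close> for
  each target point \<open>a\<close>.\<close>

lemma min_time_triangle:
  assumes "convex F" "A \<noteq> {}"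
  shows "min_time F A y \<le> minkowski_gauge F (x - y) + min_time F A x"
proof -
  have "min_time F A y \<le> (INF a\<in>A. minkowski_gauge F (x - y) + minkowski_gauge F (a - x))"
  proof (rule INF_greatest)
    fix a assume "a \<in> A"
    then have "min_time F A y \<le> minkowski_gauge F ((x - y) + (a - x))"
      using min_time_le_gauge[of a A F y] by simp
    also have "\<dots> \<le> minkowski_gauge F (x - y) + minkowski_gauge F (a - x)"
      by (rule minkowski_gauge_add_le[OF assms(1)])
    finally show "min_time F A y \<le> \<dots>" .
  qed
  \<comment> \<open>The constant passes through the infimum because \<open>A\<close> is nonempty and
    gauges are nonnegative.\<close>
  also have "\<dots> = minkowski_gauge F (x - y) + min_time F A x"
    unfolding min_time_eq_INF_gauge
    by (rule INF_ereal_add_right) (use assms minkowski_gauge_nonneg[of F "x - y"]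
        in \<open>auto intro: minkowski_gauge_nonneg\<close>)
  finally show ?thesis .
qed

section \<open>The estimate along a segment\<close>

lemma min_time_add_le_gauge:
  fixes F :: "'a::topological_real_vector set"
  assumes F: "0 \<in> interior F" and sym: "F = uminus ` F"
    and x: "x \<notin> \<Omega>" and y: "y \<in> \<Omega>"
  shows "min_time F \<Omega> x + min_time F (- \<Omega>) y \<le> minkowski_gauge F (x - y)"
proof -
  have zero: "0 \<in> F" using F interior_subset by blast
  obtain r where r: "0 \<le> r" "minkowski_gauge F (x - y) = ereal r"
    using minkowski_gauge_finite[OF F] .
  obtain d where d: "min_time F \<Omega> x = ereal d"
    using min_time_finite[OF F, of \<Omega> x] y by auto
  obtain e where e: "min_time F (- \<Omega>) y = ereal e"
    using min_time_finite[OF F, of "- \<Omega>" y] x by auto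
  have r': "minkowski_gauge F (y - x) = ereal r"
    using minkowski_gauge_uminus[OF sym, of "x - y"] r by simp
  have step: "d + e \<le> r + r * inverse (real (Suc n))" for n
  proof -
    \<comment> \<open>The successor keeps the divisor positive and fits the form of
      \<open>LIMSEQ_inverse_real_of_nat\<close>.\<close>
    define N where "N = Suc n"
    define z where "z k = y + (real k / real N) *\<^sub>R (x - y)" for k
    have "z 0 \<in> \<Omega>" "z N \<notin> \<Omega>"
      using x y by (auto simp: z_def N_def)
    \<comment> \<open>\<open>Suc k\<close> is the first index at which the subdivision leaves
      \<open>\<Omega>\<close>.\<close>
    then obtain k where k: "k < N" "z k \<in> \<Omega>" "z (Suc k) \<notin> \<Omega>"
      using ex_least_nat_less[of "\<lambda>k. z k \<notin> \<Omega>" N] by auto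
    have "ereal d \<le> minkowski_gauge F (z k - x)"
      using min_time_le_gauge[OF k(2), of F x] d by simp
    also have "z k - x = (1 - real k / real N) *\<^sub>R (y - x)"
      by (simp add: z_def algebra_simps)
    also have "minkowski_gauge F \<dots> \<le> ereal ((1 - real k / real N) * r)"
      by (rule minkowski_gauge_scaleR_le[OF zero _ r']) (use k in \<open>simp add: field_simps\<close>)
    finally have 1: "d \<le> (1 - real k / real N) * r" by simp
    have "ereal e \<le> minkowski_gauge F (z (Suc k) - y)"
      using min_time_le_gauge[of "z (Suc k)" "- \<Omega>" F y] k(3) e by simp
    also have "z (Suc k) - y = (real (Suc k) / real N) *\<^sub>R (x - y)"
      by (simp add: z_def)
    also have "minkowski_gauge F \<dots> \<le> ereal ((real (Suc k) / real N) * r)"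
      by (rule minkowski_gauge_scaleR_le[OF zero _ r(2)]) simp
    finally have 2: "e \<le> (real (Suc k) / real N) * r" by simp
    \<comment> \<open>The way back from \<open>x\<close> to \<open>z k\<close> and the way from
      \<open>y\<close> to \<open>z (Suc k)\<close> overlap in exactly one piece, which costs the
      extra \<open>r / N\<close>.\<close>
    have "(1 - real k / real N) * r + (real (Suc k) / real N) * r = r + r * inverse (real N)"
      by (simp add: N_def add_divide_distrib algebra_simps divide_inverse)
    with 1 2 show ?thesis unfolding N_def by linarith
  qed
  have "(\<lambda>n. r + r * inverse (real (Suc n))) \<longlonglongrightarrow> r + r * 0"
    by (intro tendsto_intros LIMSEQ_inverse_real_of_nat)
  then have "d + e \<le> r"
    using LIMSEQ_le_const[of _ "r + r * 0" "d + e"] step by auto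
  then show ?thesis by (simp add: d e r)
qed

section \<open>Evaluation of the infimal convolution\<close>

theorem theorem5p5:
  fixes F \<Omega> :: "'a::{locally_convex_space, t2_space} set"
  assumes "convex F"
    and "0 \<in> interior F"
    and "\<Omega> \<noteq> {}"
    and "- \<Omega> \<noteq> {}"
  shows "(\<forall>x\<in>\<Omega>. signed_min_time F \<Omega> x
            = inf_convolution (inner_min_time F \<Omega>) (minkowski_gauge F) x)
       \<and> (F = uminus ` F \<longrightarrow>
            (\<forall>x. signed_min_time F \<Omega> x
               = inf_convolution (inner_min_time F \<Omega>) (minkowski_gauge F) x))"
proof -
  have zero: "0 \<in> F" using assms(2) interior_subset by blast
  have inside: "signed_min_time F \<Omega> x
      = inf_convolution (inner_min_time F \<Omega>) (minkowski_gauge F) x" if x: "x \<in> \<Omega>" for x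
  proof (rule antisym)
    show "signed_min_time F \<Omega> x
        \<le> inf_convolution (inner_min_time F \<Omega>) (minkowski_gauge F) x"
      unfolding inf_convolution_def
    proof (rule INF_greatest)
      fix y
      obtain d where "min_time F (- \<Omega>) x = ereal d"
        using min_time_finite[OF assms(2,4)] .
      moreover obtain e where "min_time F (- \<Omega>) y = ereal e"
        using min_time_finite[OF assms(2,4)] .
      moreover obtain r where "minkowski_gauge F (x - y) = ereal r"
        using minkowski_gauge_finite[OF assms(2)] .
      \<comment> \<open>For \<open>y\<close> outside \<open>\<Omega>\<close> the right side is
        infinite; otherwise the triangle inequality is rearranged between real numbers.\<close>
      ultimately show "signed_min_time F \<Omega> x
          \<le> inner_min_time F \<Omega> y + minkowski_gauge F (x - y)"
        using min_time_triangle[OF assms(1,4), of y x] x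
        by (simp add: signed_min_time_def inner_min_time_def)
    qed
    have "inf_convolution (inner_min_time F \<Omega>) (minkowski_gauge F) x
        \<le> inner_min_time F \<Omega> x + minkowski_gauge F (x - x)"
      unfolding inf_convolution_def by (rule INF_lower) simp
    then show "inf_convolution (inner_min_time F \<Omega>) (minkowski_gauge F) x
        \<le> signed_min_time F \<Omega> x"
      using x by (simp add: minkowski_gauge_zero[OF zero] inner_min_time_def signed_min_time_def)
  qed
  have outside: "signed_min_time F \<Omega> x
      = inf_convolution (inner_min_time F \<Omega>) (minkowski_gauge F) x"
    if x: "x \<notin> \<Omega>" and sym: "F = uminus ` F" for x
  proof (rule antisym)
    show "signed_min_time F \<Omega> x
        \<le> inf_convolution (inner_min_time F \<Omega>) (minkowski_gauge F) x"
      unfolding inf_convolution_def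
    proof (rule INF_greatest)
      fix y
      obtain d where "min_time F \<Omega> x = ereal d"
        using min_time_finite[OF assms(2,3)] .
      moreover obtain e where "min_time F (- \<Omega>) y = ereal e"
        using min_time_finite[OF assms(2,4)] .
      moreover obtain r where "minkowski_gauge F (x - y) = ereal r"
        using minkowski_gauge_finite[OF assms(2)] .
      ultimately show "signed_min_time F \<Omega> x
          \<le> inner_min_time F \<Omega> y + minkowski_gauge F (x - y)"
        using min_time_add_le_gauge[OF assms(2) sym x, of y] x
        by (auto simp: signed_min_time_def inner_min_time_def)
    qed
    \<comment> \<open>On \<open>\<Omega>\<close> the inner function is at most \<open>0\<close>, so
      each \<open>y\<close> there bounds the convolution by a gauge. By symmetry this is the gauge
      of \<open>y - x\<close>, and the infimum over \<open>y\<close> is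
      \<open>min_time F \<Omega> x\<close>.\<close>
    have "inf_convolution (inner_min_time F \<Omega>) (minkowski_gauge F) x
        \<le> minkowski_gauge F (y - x)" if y: "y \<in> \<Omega>" for y
    proof -
      have "inf_convolution (inner_min_time F \<Omega>) (minkowski_gauge F) x
          \<le> inner_min_time F \<Omega> y + minkowski_gauge F (x - y)"
        unfolding inf_convolution_def by (rule INF_lower) simp
      also have "\<dots> \<le> 0 + minkowski_gauge F (x - y)"
        using y min_time_nonneg[of F "- \<Omega>" y]
        by (intro add_right_mono) (simp add: inner_min_time_def)
      also have "\<dots> = minkowski_gauge F (y - x)"
        using minkowski_gauge_uminus[OF sym, of "x - y"] by simp
      finally show ?thesis .
    qed
    then show "inf_convolution (inner_min_time F \<Omega>) (minkowski_gauge F) x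
        \<le> signed_min_time F \<Omega> x"
      using x by (simp add: signed_min_time_def min_time_eq_INF_gauge INF_greatest)
  qed
  show ?thesis using inside outside by blast
qed

end
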